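(* For $r>1$ let $w_r=(1,r,-1)\in\mathbb{W}$, and for $r=1$ let $w_1=(1,1,0)\in\mathbb{W}$. For all real $r\ge1$ the point $w_r$ is periodic for $\mathcal{P}_h$ and has (minimal) period $$\operatorname{per}(r)=2\cdot\#\{(a,b)\in\mathbb{N}\times\mathbb{N}:\gcd(a,b)=1,\ ab<r\}+\#\{(a,b)\in\mathbb{N}\times\mathbb{N}:\gcd(a,b)=1,\ ab=r\}.$$ In addition, a point $(\gamma,r,\varepsilon)\in\mathbb{W}$ is periodic for $\mathcal{P}_h$ if and only if $\gamma\in\mathbb{Q}$, and in this case, if $\gamma=a/b$ with $a,b\in\mathbb{N}$ coprime, it is in the $\mathcal{P}_h$-orbit of the point $w_{rb^2}$.
   Context: $\mathbb{R}^+=(0,\infty)$ and $\mathbb{N}=\{1,2,3,\dots\}$. Let $$\mathbb{W}=\{(\gamma,r,\varepsilon)\in\mathbb{R}^+\times\mathbb{R}^+\times\{-1,0,+1\}: r\ge\gamma,\ \varepsilon=0\text{ iff }r=\gamma\}.$$ The map $\mathcal{P}_h:\mathbb{W}\to\mathbb{W}$ (the Poincaré map of the positive horocycle flow on the modular surface for negative times, in suitable coordinates) is given explicitly as follows. If $\varepsilon=+1$: $\mathcal{P}_h(\gamma,r,+1)=(\gamma-1,r,+1)$ if $\gamma>1$; $=(1,r,-1)$ if $\gamma=1$; $=\big(\frac1{1-\gamma},\frac r{(1-\gamma)^2},-1\big)$ if $\gamma<1$, $r>1-\gamma$; $=\big(\frac1{1-\gamma},\frac1{1-\gamma},0\big)$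 if $\gamma<1$, $r=1-\gamma$; $=\big(\frac\gamma{1-\gamma},\frac r{(1-\gamma)^2},+1\big)$ if $\gamma<1$, $r<1-\gamma$. If $\varepsilon=-1$: $\mathcal{P}_h(\gamma,r,-1)=\big(\frac\gamma{1+\gamma},\frac r{(1+\gamma)^2},-1\big)$ if $r>\gamma(1+\gamma)$; $=\big(\frac\gamma{1+\gamma},\frac\gamma{1+\gamma},0\big)$ if $r=\gamma(1+\gamma)$; $=(\gamma+1,r,-1)$ if $\gamma>1$, $1+\gamma<r<\gamma(1+\gamma)$; $=(\gamma+1,\gamma+1,0)$ if $\gamma>1$, $r=1+\gamma$; $=(\gamma,r,+1)$ if $r<\min\{1+\gamma,\gamma(1+\gamma)\}$. If $\varepsilon=0$ (so $r=\gamma$): $\mathcal{P}_h(\gamma,\gamma,0)=(\gamma-1,\gamma,+1)$ if $\gamma>1$; $=(1,1,0)$ if $\gamma=1$; $=\big(\frac1{1-\gamma},\frac\gamma{(1-\gamma)^2},-1\big)$ if $\frac12<\gamma<1$; $=(2,2,0)$ if $\gamma=\frac12$; $=\big(\frac\gamma{1-\gamma},\frac\gamma{(1-\gamma)^2},+1\big)$ if $\gamma<\frac12$. *)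

theory Defs
  imports Complex_Main "HOL-Combinatorics.Orbits" "HOL-Combinatorics.Cycles"
begin

definition \<W> :: "(real \<times> real \<times> int) set" where
  "\<W> = {(\<gamma>, r, \<epsilon>). \<gamma> > 0 \<and> r > 0 \<and> \<epsilon> \<in> {-1, 0, 1} \<and> r \<ge> \<gamma> \<and> (\<epsilon> = 0 \<longleftrightarrow> r = \<gamma>)}"

text \<open>The map is only meaningful on \<open>\<W>\<close>. There the listed cases are exhaustive, and
  \<open>\<W>\<close> is mapped into itself, as shown in \<open>P_h_in_W\<close> below; the value \<open>undefined\<close> never occurs.\<close>

definition P_h :: "real \<times> real \<times> int \<Rightarrow> real \<times> real \<times> int" where
  "P_h = (\<lambda>(\<gamma>, r, \<epsilon>).
     if \<epsilon> = 1 then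
       (if \<gamma> > 1 then (\<gamma> - 1, r, 1)
        else if \<gamma> = 1 then (1, r, -1)
        else if \<gamma> < 1 \<and> r > 1 - \<gamma> then (1 / (1 - \<gamma>), r / (1 - \<gamma>)\<^sup>2, -1)
        else if \<gamma> < 1 \<and> r = 1 - \<gamma> then (1 / (1 - \<gamma>), 1 / (1 - \<gamma>), 0)
        else if \<gamma> < 1 \<and> r < 1 - \<gamma> then (\<gamma> / (1 - \<gamma>), r / (1 - \<gamma>)\<^sup>2, 1)
        else undefined)
     else if \<epsilon> = -1 then
       (if r > \<gamma> * (1 + \<gamma>) then (\<gamma> / (1 + \<gamma>), r / (1 + \<gamma>)\<^sup>2, -1)
        else if r = \<gamma> * (1 + \<gamma>) then (\<gamma> / (1 + \<gamma>), \<gamma> / (1 + \<gamma>), 0)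
        else if \<gamma> > 1 \<and> 1 + \<gamma> < r \<and> r < \<gamma> * (1 + \<gamma>) then (\<gamma> + 1, r, -1)
        else if \<gamma> > 1 \<and> r = 1 + \<gamma> then (\<gamma> + 1, \<gamma> + 1, 0)
        else if r < min (1 + \<gamma>) (\<gamma> * (1 + \<gamma>)) then (\<gamma>, r, 1)
        else undefined)
     else if \<epsilon> = 0 then
       (if \<gamma> > 1 then (\<gamma> - 1, \<gamma>, 1)
        else if \<gamma> = 1 then (1, 1, 0)
        else if 1/2 < \<gamma> \<and> \<gamma> < 1 then (1 / (1 - \<gamma>), \<gamma> / (1 - \<gamma>)\<^sup>2, -1)
        else if \<gamma> = 1/2 then (2, 2, 0)
        else if \<gamma> < 1/2 then (\<gamma> / (1 - \<gamma>), \<gamma> / (1 - \<gamma>)\<^sup>2, 1)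
        else undefined)
     else undefined)"

lemma P_h_in_W:
  assumes "p \<in> \<W>"
  shows "P_h p \<in> \<W>"
proof -
  obtain g r e where p: "p = (g, r, e)" by (cases p) auto
  have W: "g > 0" "r > 0" "r \<ge> g" "e = -1 \<or> e = 0 \<or> e = 1" "e = 0 \<longleftrightarrow> r = g"
    using assms by (auto simp: p \<W>_def)
  have key: "c / d < s / d\<^sup>2 \<longleftrightarrow> c * d < s" if "d > 0" for c d s :: real
  proof -
    have "c / d = (c * d) / d\<^sup>2" using that by (simp add: power2_eq_square)
    then show ?thesis using that by (simp only: divide_less_cancel) auto
  qed
  have dn: "g / (1 + g) < r / (1 + g)\<^sup>2 \<longleftrightarrow> g * (1 + g) < r"
    using W by (intro key) simp
  have "g * g > 0" using W by simp
  then have sq: "g * (1 - g) < r" "g * (1 - g) < g"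
    using W(3) unfolding right_diff_distrib by linarith+
  have up0: "g / (1 - g) < r / (1 - g)\<^sup>2" "g / (1 - g) < g / (1 - g)\<^sup>2" if "g < 1"
    using key[of "1 - g" g] sq that by auto
  have up1: "1 / (1 - g) < s / (1 - g)\<^sup>2" if "g < 1" "1 - g < s" for s
    using key[of "1 - g" 1 s] that by auto
  consider "e = 1" | "e = -1" | "e = 0" using W by blast
  then show ?thesis
  proof cases
    case 1
    with W have gr: "g < r" by auto
    consider "g > 1" | "g = 1" | "g < 1" "r > 1 - g" | "g < 1" "r = 1 - g" | "g < 1" "r < 1 - g"
      by linarith
    then show ?thesis
    proof cases
      case 3
      with 1 W up1[of r] show ?thesis by (simp add: p P_h_def \<W>_def)
    next
      case 5
      with 1 W up0 show ?thesis by (simp add: p P_h_def \<W>_def)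
    qed (use 1 W gr in \<open>auto simp: p P_h_def \<W>_def\<close>)
  next
    case 2
    with W have gr: "g < r" by auto
    consider "g * (1 + g) < r" | "r = g * (1 + g)" | "r < g * (1 + g)" by linarith
    then show ?thesis
    proof cases
      case 3
      have "g > 1" if "1 + g \<le> r"
      proof (rule ccontr)
        assume "\<not> g > 1"
        then have "g * (1 + g) \<le> 1 * (1 + g)" using W by (intro mult_right_mono) auto
        with 3 that show False by simp
      qed
      with 2 3 W gr show ?thesis by (auto simp: p P_h_def \<W>_def)
    qed (use 2 W dn gr in \<open>auto simp: p P_h_def \<W>_def\<close>)
  next
    case 3
    with W have r: "r = g" by simp
    consider "g > 1" | "g = 1" | "1/2 < g" "g < 1" | "g = 1/2" | "g < 1/2" by linarith
    then show ?thesis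
    proof cases
      case 3
      with \<open>e = 0\<close> W up1[of g] show ?thesis by (simp add: p P_h_def \<W>_def)
    next
      case 5
      with \<open>e = 0\<close> W up0 r show ?thesis by (auto simp: p P_h_def \<W>_def)
    qed (use \<open>e = 0\<close> r in \<open>auto simp: p P_h_def \<W>_def\<close>)
  qed
qed

definition periodic_point :: "('a \<Rightarrow> 'a) \<Rightarrow> 'a \<Rightarrow> bool" where
  "periodic_point f x \<longleftrightarrow> (\<exists>n>0. (f ^^ n) x = x)"

text \<open>Intended for \<open>r \<ge> 1\<close> only.\<close>

definition w :: "real \<Rightarrow> real \<times> real \<times> int" where
  "w r = (if r = 1 then (1, 1, 0) else (1, r, -1))"

definition per :: "real \<Rightarrow> nat" where
  "per r = 2 * card {(a :: nat, b :: nat). a \<ge> 1 \<and> b \<ge> 1 \<and> gcd a b = 1 \<and> real (a * b) < r}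
             + card {(a :: nat, b :: nat). a \<ge> 1 \<and> b \<ge> 1 \<and> gcd a b = 1 \<and> real (a * b) = r}"

end

theory Submission
  imports Defs
begin

text \<open>
  The map is a cyclic depth-first traversal of a Stern--Brocot tree. For fixed \<open>R > 0\<close> take as nodes
  the pairs \<open>(x, y)\<close> of positive reals with \<open>x y \<le> R\<close>; the children of \<open>(x, y)\<close> are \<open>(x, x + y)\<close> and
  \<open>(x + y, y)\<close>, provided that they are still nodes. The point \<open>(x / y, R / y\<^sup>2, \<epsilon>)\<close> says that the
  traversal visits \<open>(x, y)\<close> on its way down (\<open>\<epsilon> = -1\<close>) or back up (\<open>\<epsilon> = 1\<close>); the nodes with
  \<open>x y = R\<close> are leaves, and are visited only once (\<open>\<epsilon> = 0\<close>).

  The coprime pairs form the tree below \<open>(1, 1)\<close>, from which the traversal restarts when it is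
  completed. So the orbit of \<open>w R\<close> consists of all visits to coprime pairs, two for \<open>a b < R\<close> and one
  for \<open>a b = R\<close>. If \<open>x / y\<close> is irrational then \<open>(x, y)\<close> has infinitely many ancestors, and the
  traversal climbs through all of them.
\<close>

section \<open>Tree coordinates and single steps of the map\<close>

definition enter :: "real \<Rightarrow> real \<Rightarrow> real \<Rightarrow> real \<times> real \<times> int" where
  "enter R x y = (x / y, R / y\<^sup>2, if x * y < R then -1 else 0)"

definition leave :: "real \<Rightarrow> real \<Rightarrow> real \<Rightarrow> real \<times> real \<times> int" where
  "leave R x y = (x / y, R / y\<^sup>2, if x * y < R then 1 else 0)"

text \<open>Dividing by \<open>y\<^sup>2\<close> turns the test whether a child of (x, y) is still a
  node into a comparison of r with g (1 + g) (left child) or with 1 + g (right child), and these are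
  the thresholds in \<open>P_h\<close> for \<epsilon> = -1. The left child is tried first.\<close>

lemma P_h_enter:
  assumes "x > 0" "y > 0" "x * y < R"
  shows "P_h (enter R x y) =
    (if x * (x + y) \<le> R then enter R x (x + y)
     else if (x + y) * y \<le> R then enter R (x + y) y
     else leave R x y)"
proof -
  define g r where "g = x / y" and "r = R / y\<^sup>2"
  have x: "x = g * y" and R: "R = r * y\<^sup>2" and g: "g > 0"
    using assms by (auto simp: g_def r_def)
  have q: "x * y = g * y\<^sup>2" "x * (x + y) = g * (1 + g) * y\<^sup>2" "(x + y) * y = (1 + g) * y\<^sup>2"
    by (auto simp: x power2_eq_square algebra_simps)
  have c: "x * y < R \<longleftrightarrow> g < r" "x * (x + y) < R \<longleftrightarrow> g * (1 + g) < r"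
      "x * (x + y) \<le> R \<longleftrightarrow> g * (1 + g) \<le> r"
      "(x + y) * y \<le> R \<longleftrightarrow> 1 + g \<le> r" "(x + y) * y < R \<longleftrightarrow> 1 + g < r"
    unfolding q R using assms by simp_all
  have s: "x / (x + y) = g / (1 + g)" "R / (x + y)\<^sup>2 = r / (1 + g)\<^sup>2" "(x + y) / y = g + 1"
  proof -
    have e: "x + y = (1 + g) * y" by (simp add: x algebra_simps)
    show "x / (x + y) = g / (1 + g)" "R / (x + y)\<^sup>2 = r / (1 + g)\<^sup>2" "(x + y) / y = g + 1"
      unfolding e using assms g by (simp_all add: x R power_mult_distrib add.commute add_divide_distrib)
  qed
  have big: "1 + g < g * (1 + g) \<longleftrightarrow> 1 < g" "1 + g \<le> g * (1 + g) \<longleftrightarrow> 1 \<le> g"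
    using mult_less_cancel_right_pos[of "1 + g" 1 g] mult_le_cancel_right_pos[of "1 + g" 1 g] g
    by simp_all
  \<comment> \<open>The guard \<gamma> > 1 in \<open>P_h\<close> holds automatically: if the right
    child is a node and the left one is not, then x > y.\<close>
  have big': "g > 1" if "r < g * (1 + g)" "1 + g \<le> r"
    using le_less_trans[OF that(2,1)] big by blast
  have z: "g / (1 + g) = r / (1 + g)\<^sup>2" if "r = g * (1 + g)"
    using that g by (simp add: power2_eq_square)
  have gr: "g < r" using assms c by simp
  show ?thesis
    unfolding enter_def leave_def c s P_h_def g_def[symmetric] r_def[symmetric]
    using z big big' gr by (auto simp: min_def)
qed

text \<open>A right child (y < x) returns to its parent. A left child passes to its right sibling
  (y, y - x) if that is a node, otherwise to its parent (x, y - x). A node with x = y has no parent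
  and restarts. Leaves are included, so the cases \<epsilon> = 0 of \<open>P_h\<close> are treated
  here as well.\<close>

lemma P_h_leave:
  assumes "x > 0" "y > 0" "x * y \<le> R"
  shows "P_h (leave R x y) =
    (if y < x then leave R (x - y) y
     else if x = y then enter R x y
     else if y * (y - x) \<le> R then enter R y (y - x)
     else leave R x (y - x))"
proof -
  define g r where "g = x / y" and "r = R / y\<^sup>2"
  have x: "x = g * y" and R: "R = r * y\<^sup>2" and g: "g > 0"
    using assms by (auto simp: g_def r_def)
  have q: "x * y = g * y\<^sup>2" "y * (y - x) = (1 - g) * y\<^sup>2" "(x - y) * y = (g - 1) * y\<^sup>2"
     "x * (y - x) = g * (1 - g) * y\<^sup>2"
    by (auto simp: x power2_eq_square algebra_simps)
  have c: "x * y < R \<longleftrightarrow> g < r" "x * y \<le> R \<longleftrightarrow> g \<le> r"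
      "y * (y - x) \<le> R \<longleftrightarrow> 1 - g \<le> r" "y * (y - x) < R \<longleftrightarrow> 1 - g < r"
      "(x - y) * y < R \<longleftrightarrow> g - 1 < r" "x * (y - x) < R \<longleftrightarrow> g * (1 - g) < r"
    unfolding q R using assms by simp_all
  have xy: "y < x \<longleftrightarrow> 1 < g" "x = y \<longleftrightarrow> g = 1"
    using assms by (simp_all add: x)
  have gr: "g \<le> r" using assms c by simp
  have s1: "(x - y) / y = g - 1" using assms by (simp add: x diff_divide_distrib)
  have s: "x / (y - x) = g / (1 - g)" "y / (y - x) = 1 / (1 - g)" "R / (y - x)\<^sup>2 = r / (1 - g)\<^sup>2"
  proof -
    have e: "y - x = (1 - g) * y" by (simp add: x algebra_simps)
    show "x / (y - x) = g / (1 - g)" "y / (y - x) = 1 / (1 - g)" "R / (y - x)\<^sup>2 = r / (1 - g)\<^sup>2"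
      unfolding e using assms g by (auto simp: x R power_mult_distrib)
  qed
  \<comment> \<open>The parent satisfies x (y - x) < x y \<le> R, so it is never a leaf and its
    \<open>leave\<close> point carries the sign 1.\<close>
  have gg: "g * (1 - g) < r"
  proof -
    have "g * (1 - g) < g" using g by (simp add: algebra_simps)
    then show ?thesis using gr by simp
  qed
  consider "g > 1" | "g = 1" | "g < 1" by linarith
  then show ?thesis
  proof cases
    case 1
    then show ?thesis using gr
      unfolding enter_def leave_def c xy s1 s P_h_def g_def[symmetric] r_def[symmetric] by auto
  next
    case 2
    then show ?thesis using gr
      unfolding enter_def leave_def c xy s1 s P_h_def g_def[symmetric] r_def[symmetric] by auto
  next
    case 3
    note defs = enter_def leave_def c xy s1 s P_h_def g_def[symmetric] r_def[symmetric]
    consider "1 - g < r" | "r = 1 - g" | "r < 1 - g" by linarith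
    then show ?thesis
    proof cases
      case 1
      with 3 gr show ?thesis unfolding defs by (cases "g = r") auto
    next
      case 2
      \<comment> \<open>The sibling is a leaf here. For g = 1/2 the node itself is a leaf too, which
        is the isolated case \<gamma> = 1/2 of \<open>P_h\<close>.\<close>
      show ?thesis
      proof (cases "g = 1 / 2")
        case True
        with 2 have "r = 1 / 2" by simp
        show ?thesis unfolding defs True \<open>r = 1 / 2\<close> by (simp add: power2_eq_square)
      next
        case False
        with 2 3 gr show ?thesis unfolding defs by (auto simp: power2_eq_square)
      qed
    next
      case A: 3
      with 3 gr gg show ?thesis unfolding defs by (cases "g = r") auto
    qed
  qed
qed

section \<open>Traversal of a subtree\<close>

text \<open>Zero steps are allowed here, whereas \<open>orbit\<close> demands a positive number, so
  that membership of a point in its own orbit means periodicity.\<close>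

definition reaches :: "('a \<Rightarrow> 'a) \<Rightarrow> 'a \<Rightarrow> 'a \<Rightarrow> bool" where
  "reaches f p q \<longleftrightarrow> (\<exists>n. (f ^^ n) p = q)"

lemma reaches_refl [simp]: "reaches f p p"
  unfolding reaches_def by (rule exI[of _ 0]) simp

lemma reaches_step: "reaches f p (f p)"
  unfolding reaches_def by (rule exI[of _ 1]) simp

lemma reaches_trans [trans]: "reaches f p q \<Longrightarrow> reaches f q s \<Longrightarrow> reaches f p s"
  unfolding reaches_def by (metis comp_apply funpow_add)

lemma reaches_leave_right:
  assumes "x > 0" "y > 0" "(x + y) * y \<le> R"
  shows "reaches P_h (leave R (x + y) y) (leave R x y)"
  using P_h_leave[of "x + y" y R] assms reaches_step[of P_h "leave R (x + y) y"] by simp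

lemma enter_eq_leave: "x * y = R \<Longrightarrow> enter R x y = leave R x y"
  by (simp add: enter_def leave_def)

text \<open>Every subtree has finite depth, so its traversal ends. By induction on a bound for the
  depth, the subtrees of the existing children are traversed one after the other, and then the map
  turns back at (x, y).\<close>

lemma reaches_enter_leave:
  assumes "x > 0" "y > 0" "x * y \<le> R"
  shows "reaches P_h (enter R x y) (leave R x y)"
proof -
  \<comment> \<open>Both coordinates stay at least \<open>d\<close> below \<open>(x, y)\<close>, so each step down lowers \<open>R - x y\<close> by at least \<open>d\<^sup>2\<close>.\<close>
  define d where "d = min x y"
  have d: "d > 0" "d \<le> x" "d \<le> y" using assms by (auto simp: d_def)
  obtain n :: nat where "R - x * y < real n * d\<^sup>2"
    using reals_Archimedean3[of "d\<^sup>2"] d by auto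
  with d(2,3) assms(3) show ?thesis
  proof (induction n arbitrary: x y)
    case 0
    then show ?case by simp
  next
    case (Suc n)
    have pos: "x > 0" "y > 0" using Suc.prems d(1) by auto
    have "d\<^sup>2 \<le> x\<^sup>2" "d\<^sup>2 \<le> y\<^sup>2" using Suc.prems d(1) by (auto intro: power_mono)
    then have bl: "R - x * (x + y) < real n * d\<^sup>2" and br: "R - (x + y) * y < real n * d\<^sup>2"
      using Suc.prems(4) by (auto simp: algebra_simps power2_eq_square)
    have left: "reaches P_h (enter R x (x + y)) (leave R x (x + y))" if "x * (x + y) \<le> R"
      using Suc.prems d(1) that bl by (intro Suc.IH) auto
    have right: "reaches P_h (enter R (x + y) y) (leave R x y)" if "(x + y) * y \<le> R"
    proof -
      have "reaches P_h (enter R (x + y) y) (leave R (x + y) y)"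
        using Suc.prems d(1) that br by (intro Suc.IH) auto
      also have "reaches P_h (leave R (x + y) y) (leave R x y)"
        using reaches_leave_right[of x y R] pos that by simp
      finally show ?thesis .
    qed
    \<comment> \<open>From the left child the map goes to the right child, whose subtree
      \<open>right\<close> completes, or straight to the parent.\<close>
    have up: "reaches P_h (leave R x (x + y)) (leave R x y)" if "x * (x + y) \<le> R"
      using reaches_step[of P_h "leave R x (x + y)"] P_h_leave[of x "x + y" R] pos that right
      by (auto split: if_splits intro: reaches_trans)
    show ?case
    proof (cases "x * y = R")
      case True
      then show ?thesis by (simp add: enter_eq_leave)
    next
      case False
      then have lt: "x * y < R" using Suc.prems by simp
      have "reaches P_h (P_h (enter R x y)) (leave R x y)"
        unfolding P_h_enter[OF pos lt] using left up right by (auto intro: reaches_trans)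
      then show ?thesis using reaches_step reaches_trans by metis
    qed
  qed
qed

text \<open>Between a left child and its parent lies the whole subtree of the right sibling, if
  there is one; \<open>reaches_enter_leave\<close> gets through it.\<close>

lemma reaches_leave_left:
  assumes "x > 0" "y > 0" "x * (x + y) \<le> R"
  shows "reaches P_h (leave R x (x + y)) (leave R x y)"
proof (cases "(x + y) * y \<le> R")
  case True
  then have "P_h (leave R x (x + y)) = enter R (x + y) y"
    using P_h_leave[of x "x + y" R] assms by simp
  then have "reaches P_h (leave R x (x + y)) (enter R (x + y) y)"
    using reaches_step[of P_h "leave R x (x + y)"] by simp
  also have "reaches P_h (enter R (x + y) y) (leave R (x + y) y)"
    using reaches_enter_leave[of "x + y" y R] assms True by simp
  also have "reaches P_h (leave R (x + y) y) (leave R x y)"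
    using reaches_leave_right[of x y R] assms True by simp
  finally show ?thesis .
next
  case False
  then have "P_h (leave R x (x + y)) = leave R x y"
    using P_h_leave[of x "x + y" R] assms by simp
  then show ?thesis
    using reaches_step[of P_h "leave R x (x + y)"] by simp
qed

lemma reaches_enter_left:
  assumes "x > 0" "y > 0" "x * (x + y) \<le> R"
  shows "reaches P_h (enter R x y) (enter R x (x + y))"
proof -
  have "x * y < x * (x + y)" using assms by simp
  then have "x * y < R" using assms by linarith
  then show ?thesis
    using P_h_enter[of x y R] assms reaches_step[of P_h "enter R x y"] by simp
qed

text \<open>The subtree of the left child, if that is a node, has to be completed before the right
  child is entered.\<close>

lemma reaches_enter_right:
  assumes "x > 0" "y > 0" "(x + y) * y \<le> R"
  shows "reaches P_h (enter R x y) (enter R (x + y) y)"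
proof (cases "x * (x + y) \<le> R")
  case True
  have "reaches P_h (enter R x y) (enter R x (x + y))"
    using reaches_enter_left assms True by simp
  also have "reaches P_h (enter R x (x + y)) (leave R x (x + y))"
    using reaches_enter_leave[of x "x + y" R] assms True by simp
  also have "reaches P_h (leave R x (x + y)) (P_h (leave R x (x + y)))"
    by (rule reaches_step)
  also have "P_h (leave R x (x + y)) = enter R (x + y) y"
    using P_h_leave[of x "x + y" R] assms True by simp
  finally show ?thesis .
next
  case False
  have "x * y < (x + y) * y" using assms by simp
  then have "x * y < R" using assms by linarith
  then show ?thesis
    using P_h_enter[of x y R] assms False reaches_step[of P_h "enter R x y"] by simp
qed

section \<open>The orbit of the root\<close>

lemma coprime_add_self_nat:
  fixes a b :: nat
  shows "coprime a (a + b) \<longleftrightarrow> coprime a b" "coprime a (b + a) \<longleftrightarrow> coprime a b"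
    "coprime (a + b) a \<longleftrightarrow> coprime a b" "coprime (b + a) a \<longleftrightarrow> coprime a b"
  by (metis coprime_iff_gcd_eq_1 gcd.commute gcd_add1 gcd_add2 add.commute)+

text \<open>Run the subtractive Euclidean algorithm backwards. It ends at a = b, where coprimality
  forces (1, 1), and each subtraction lowers the product, so all intermediate pairs are
  nodes.\<close>

lemma reaches_enter_coprime:
  fixes a b :: nat
  assumes "a \<ge> 1" "b \<ge> 1" "coprime a b" "real (a * b) \<le> R"
  shows "reaches P_h (enter R 1 1) (enter R (real a) (real b))"
  using assms
proof (induction "a + b" arbitrary: a b rule: less_induct)
  case less
  consider "a = b" | "a < b" | "b < a" by linarith
  then show ?case
  proof cases
    case 1
    with less.prems show ?thesis by simp
  next
    case 2
    then obtain c where c: "b = a + c" "c \<ge> 1" using less_imp_add_positive[of a b] by auto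
    have "real (a * c) \<le> real (a * b)" unfolding c of_nat_le_iff by simp
    then have "real (a * c) \<le> R" using less.prems by linarith
    then have "reaches P_h (enter R 1 1) (enter R (real a) (real c))"
      using less.prems c by (intro less.hyps) (auto simp: coprime_add_self_nat)
    also have "reaches P_h (enter R (real a) (real c)) (enter R (real a) (real a + real c))"
      using less.prems c by (intro reaches_enter_left) auto
    finally show ?thesis using c by simp
  next
    case 3
    then obtain c where c: "a = c + b" "c \<ge> 1" using less_imp_add_positive[of b a] by auto
    have "real (c * b) \<le> real (a * b)" unfolding c of_nat_le_iff by simp
    then have "real (c * b) \<le> R" using less.prems by linarith
    then have "reaches P_h (enter R 1 1) (enter R (real c) (real b))"
      using less.prems c by (intro less.hyps) (auto simp: coprime_add_self_nat coprime_commute)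
    also have "reaches P_h (enter R (real c) (real b)) (enter R (real c + real b) (real b))"
      using less.prems c by (intro reaches_enter_right) auto
    finally show ?thesis using c by simp
  qed
qed


text \<open>The two points coincide exactly when a b = R, which gives the weights 2 and 1 in
  \<open>per\<close>.\<close>

definition states :: "real \<Rightarrow> (real \<times> real \<times> int) set" where
  "states R = (\<Union>(a, b) \<in> {(a :: nat, b :: nat). a \<ge> 1 \<and> b \<ge> 1 \<and> coprime a b \<and> real (a * b) \<le> R}.
     {enter R (real a) (real b), leave R (real a) (real b)})"

lemma states_iff:
  "p \<in> states R \<longleftrightarrow> (\<exists>a b :: nat. a \<ge> 1 \<and> b \<ge> 1 \<and> coprime a b \<and> real (a * b) \<le> R \<and>
     (p = enter R (real a) (real b) \<or> p = leave R (real a) (real b)))"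
  by (auto simp: states_def)

lemma
  assumes "a \<ge> 1" "b \<ge> 1" "coprime a b" "real (a * b) \<le> R"
  shows enter_in_states: "enter R (real a) (real b) \<in> states R"
    and leave_in_states: "leave R (real a) (real b) \<in> states R"
  using assms by (auto simp: states_iff)

text \<open>Parents and siblings of coprime pairs are coprime. A parent has a smaller product, and
  the product of a sibling is tested by the map itself.\<close>

lemma P_h_leave_in_states:
  fixes a b :: nat
  assumes "a \<ge> 1" "b \<ge> 1" "coprime a b" "real (a * b) \<le> R"
  shows "P_h (leave R (real a) (real b)) \<in> states R"
proof -
  have step: "P_h (leave R (real a) (real b)) =
    (if real b < real a then leave R (real a - real b) (real b)
     else if real a = real b then enter R (real a) (real b)
     else if real b * (real b - real a) \<le> R then enter R (real b) (real b - real a)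
     else leave R (real a) (real b - real a))"
    using assms by (intro P_h_leave) auto
  consider "a = b" | "a < b" | "b < a" by linarith
  then show ?thesis
  proof cases
    case 1
    then show ?thesis using step assms enter_in_states[of a b R] by simp
  next
    case 2
    then obtain c where c: "b = a + c" "c \<ge> 1" using less_imp_add_positive[of a b] by auto
    have "real (a * c) \<le> real (a * b)" unfolding c of_nat_le_iff by simp
    then have le: "real (a * c) \<le> R" using assms by linarith
    have cp: "coprime a c" "coprime b c"
      using assms c by (simp_all add: coprime_add_self_nat coprime_commute)
    show ?thesis
      using step assms c le cp enter_in_states[of b c R] leave_in_states[of a c R] by auto
  next
    case 3
    then obtain c where c: "a = c + b" "c \<ge> 1" using less_imp_add_positive[of b a] by auto
    have "real (c * b) \<le> real (a * b)" unfolding c of_nat_le_iff by simp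
    then have le: "real (c * b) \<le> R" using assms by linarith
    have "coprime c b" using assms c by (simp add: coprime_add_self_nat coprime_commute)
    then show ?thesis
      using step assms c le leave_in_states[of c b R] by auto
  qed
qed

lemma P_h_in_states:
  assumes "p \<in> states R"
  shows "P_h p \<in> states R"
proof -
  obtain a b :: nat where ab: "a \<ge> 1" "b \<ge> 1" "coprime a b" "real (a * b) \<le> R"
    and p: "p = enter R (real a) (real b) \<or> p = leave R (real a) (real b)"
    using assms by (auto simp: states_iff)
  \<comment> \<open>Leaves are counted as \<open>leave\<close> points, which leaves the strict
    inequality that \<open>P_h_enter\<close> needs in the other case.\<close>
  consider "p = leave R (real a) (real b)" | "p = enter R (real a) (real b)" "real a * real b < R"
    using p ab(4) enter_eq_leave[of "real a" "real b" R] by fastforce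
  then show ?thesis
  proof cases
    case 1
    then show ?thesis using P_h_leave_in_states ab by simp
  next
    case 2
    have "coprime a (a + b)" "coprime (a + b) b"
      using ab by (simp_all add: coprime_add_self_nat coprime_commute)
    then show ?thesis
      using 2 P_h_enter[of "real a" "real b" R] ab enter_in_states[of a "a + b" R]
        enter_in_states[of "a + b" b R] leave_in_states[of a b R]
      by auto
  qed
qed

lemma w_eq_enter: "r \<ge> 1 \<Longrightarrow> w r = enter r 1 1"
  by (auto simp: w_def enter_def)

lemma w_in_orbit_w:
  assumes "r \<ge> 1"
  shows "w r \<in> orbit P_h (w r)"
proof -
  have "reaches P_h (enter r 1 1) (leave r 1 1)"
    using reaches_enter_leave[of 1 1 r] assms by simp
  then obtain n where n: "(P_h ^^ n) (enter r 1 1) = leave r 1 1"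
    by (auto simp: reaches_def)
  have "P_h (leave r 1 1) = enter r 1 1"
    using P_h_leave[of 1 1 r] assms by simp
  \<comment> \<open>The restart step makes the number of iterations positive, even for r = 1, where
    \<open>enter\<close> and \<open>leave\<close> coincide at the root.\<close>
  with n have "(P_h ^^ Suc n) (enter r 1 1) = enter r 1 1" by simp
  then show ?thesis unfolding w_eq_enter[OF assms] orbit_altdef mem_Collect_eq
    by (metis zero_less_Suc)
qed

lemma orbit_w:
  assumes "r \<ge> 1"
  shows "orbit P_h (w r) = states r"
proof
  have w: "w r \<in> states r"
    using assms enter_in_states[of 1 1 r] by (simp add: w_eq_enter)
  have "p \<in> states r" if "p \<in> orbit P_h (w r)" for p
    using that by (induction rule: orbit.induct) (auto intro: P_h_in_states w)
  then show "orbit P_h (w r) \<subseteq> states r" by blast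
  show "states r \<subseteq> orbit P_h (w r)"
  proof
    fix p assume "p \<in> states r"
    then obtain a b :: nat where ab: "a \<ge> 1" "b \<ge> 1" "coprime a b" "real (a * b) \<le> r"
      and p: "p = enter r (real a) (real b) \<or> p = leave r (real a) (real b)"
      by (auto simp: states_iff)
    have "reaches P_h (w r) (enter r (real a) (real b))"
      using reaches_enter_coprime[OF ab] assms by (simp add: w_eq_enter)
    moreover have "reaches P_h (enter r (real a) (real b)) (leave r (real a) (real b))"
      using ab by (intro reaches_enter_leave) auto
    ultimately have "reaches P_h (w r) p" using p reaches_trans by metis
    \<comment> \<open>Reaching p in zero steps does no harm, because \<open>w r\<close> lies in its
      own orbit.\<close>
    then show "p \<in> orbit P_h (w r)"
      using funpow_in_orbit[OF w_in_orbit_w[OF assms]] by (auto simp: reaches_def)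
  qed
qed

section \<open>Counting the orbit\<close>

text \<open>For fixed R the second coordinate determines y > 0, and then the first determines
  x.\<close>

lemma
  assumes "y > 0" "y' > 0" "R > 0"
  shows enter_eq_iff: "enter R x y = enter R x' y' \<longleftrightarrow> x = x' \<and> y = y'"
    and leave_eq_iff: "leave R x y = leave R x' y' \<longleftrightarrow> x = x' \<and> y = y'"
proof -
  have "x = x' \<and> y = y'" if "x / y = x' / y'" "R / y\<^sup>2 = R / y'\<^sup>2"
  proof -
    have "y\<^sup>2 = y'\<^sup>2" using that(2) assms by simp
    then have "y = y'" using assms by simp
    then show ?thesis using that(1) assms by simp
  qed
  then show "enter R x y = enter R x' y' \<longleftrightarrow> x = x' \<and> y = y'"
    "leave R x y = leave R x' y' \<longleftrightarrow> x = x' \<and> y = y'"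
    unfolding enter_def leave_def by blast+
qed

lemma finite_nat_pairs_mult_le:
  "finite {(a :: nat, b :: nat). a \<ge> 1 \<and> b \<ge> 1 \<and> real (a * b) \<le> R}"
proof (rule finite_subset)
  show "{(a :: nat, b :: nat). a \<ge> 1 \<and> b \<ge> 1 \<and> real (a * b) \<le> R} \<subseteq> {..nat \<lfloor>R\<rfloor>} \<times> {..nat \<lfloor>R\<rfloor>}"
  proof clarify
    fix a b :: nat assume "a \<ge> 1" "b \<ge> 1" "real (a * b) \<le> R"
    then have "a * b \<le> nat \<lfloor>R\<rfloor>" by (simp add: le_nat_floor)
    moreover have "a \<le> a * b" "b \<le> a * b" using \<open>a \<ge> 1\<close> \<open>b \<ge> 1\<close> by simp_all
    ultimately show "a \<in> {..nat \<lfloor>R\<rfloor>} \<and> b \<in> {..nat \<lfloor>R\<rfloor>}" unfolding atMost_iff by linarith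
  qed
qed simp

lemma card_states:
  assumes "r > 0"
  shows "card (states r) = per r"
proof -
  define A B where
    "A = {(a :: nat, b :: nat). a \<ge> 1 \<and> b \<ge> 1 \<and> gcd a b = 1 \<and> real (a * b) < r}" and
    "B = {(a :: nat, b :: nat). a \<ge> 1 \<and> b \<ge> 1 \<and> gcd a b = 1 \<and> real (a * b) = r}"
  define f g where "f = (\<lambda>(a :: nat, b :: nat). enter r (real a) (real b))"
    and "g = (\<lambda>(a :: nat, b :: nat). leave r (real a) (real b))"
  have fin: "finite A" "finite B"
    by (rule finite_subset[OF _ finite_nat_pairs_mult_le[of r]]; force simp: A_def B_def)+
  have "inj_on f {(a, b). b > 0}" "inj_on g {(a, b). b > 0}"
    using assms by (auto simp: inj_on_def f_def g_def enter_eq_iff leave_eq_iff)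
  then have inj: "inj_on f A" "inj_on g A" "inj_on f B"
    unfolding A_def B_def by (auto elim!: inj_on_subset)
  \<comment> \<open>The signs -1, 1 and 0 separate the three images.\<close>
  have disj: "f ` A \<inter> g ` A = {}" "(f ` A \<union> g ` A) \<inter> f ` B = {}"
    by (auto simp: A_def B_def f_def g_def enter_def leave_def)
  have "g ` B = f ` B"
    by (rule image_cong) (auto simp: B_def f_def g_def enter_eq_leave)
  moreover have "states r = f ` (A \<union> B) \<union> g ` (A \<union> B)"
  proof -
    have "{(a :: nat, b :: nat). a \<ge> 1 \<and> b \<ge> 1 \<and> coprime a b \<and> real (a * b) \<le> r} = A \<union> B"
      unfolding A_def B_def by (auto simp: coprime_iff_gcd_eq_1)
    then have "states r = (\<Union>p \<in> A \<union> B. {f p, g p})"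
      unfolding states_def f_def g_def by (simp add: case_prod_unfold)
    then show ?thesis by blast
  qed
  ultimately have "states r = (f ` A \<union> g ` A) \<union> f ` B" by auto
  then have "card (states r) = card A + card A + card B"
    using fin disj by (simp add: card_Un_disjoint card_image inj)
  then show ?thesis by (simp add: per_def A_def B_def)
qed

text \<open>Both sides equal the first return time: the iterates before the first return are
  distinct and exhaust the orbit.\<close>

lemma least_power_eq_card_orbit:
  assumes "x \<in> orbit f x"
  shows "least_power f x = card (orbit f x)"
proof -
  have "least_power f x = funpow_dist1 f x x"
    unfolding least_power_def
    using funpow_dist1_prop[OF assms] funpow_dist1_least[of _ f x x]
    by (intro Least_equality) (auto simp: not_less[symmetric])
  then show ?thesis
    using orbit_conv_funpow_dist1[OF assms] card_image[OF inj_on_funpow_dist1[OF assms]] by simp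
qed

section \<open>Periodicity and rationality\<close>

lemma periodic_point_iff_orbit: "periodic_point f x \<longleftrightarrow> x \<in> orbit f x"
  by (auto simp: periodic_point_def orbit_altdef) metis

text \<open>The scale y is free: a point of \<open>\<W>\<close> is a visit to (\<gamma> y, y) in the
  tree with R = \<open>r * y\<^sup>2\<close>. Irrational points are treated with y = 1; for \<gamma>
  = a/b the choice y = b makes the node the integer pair (a, b).\<close>

lemma W_eq_enter_or_leave:
  assumes "(\<gamma>, r, \<epsilon>) \<in> \<W>" "y > 0"
  shows "\<gamma> * y > 0" "(\<gamma> * y) * y \<le> r * y\<^sup>2"
    "(\<gamma>, r, \<epsilon>) = enter (r * y\<^sup>2) (\<gamma> * y) y \<or> (\<gamma>, r, \<epsilon>) = leave (r * y\<^sup>2) (\<gamma> * y) y"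
proof -
  have e: "(\<gamma> * y) * y = \<gamma> * y\<^sup>2" by (simp add: power2_eq_square)
  show "\<gamma> * y > 0" "(\<gamma> * y) * y \<le> r * y\<^sup>2"
    "(\<gamma>, r, \<epsilon>) = enter (r * y\<^sup>2) (\<gamma> * y) y \<or> (\<gamma>, r, \<epsilon>) = leave (r * y\<^sup>2) (\<gamma> * y) y"
    unfolding enter_def leave_def e using assms
    by (auto simp: \<W>_def mult_le_cancel_right mult_less_cancel_right)
qed

text \<open>A periodic orbit is finite, but this one climbs forever: a node with irrational ratio
  always has a parent, again of irrational ratio, whose \<open>leave\<close> point is
  reached.\<close>

lemma not_periodic_if_irrational:
  assumes "(\<gamma>, r, \<epsilon>) \<in> \<W>" "\<gamma> \<notin> \<rat>"
  shows "\<not> periodic_point P_h (\<gamma>, r, \<epsilon>)"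
proof
  let ?p = "(\<gamma>, r, \<epsilon>)"
  assume "periodic_point P_h ?p"
  then have p: "?p \<in> orbit P_h ?p" by (simp add: periodic_point_iff_orbit)
  have r: "r > 0" using assms by (auto simp: \<W>_def)
  define N where "N = {(x, y). x > 0 \<and> y > 0 \<and> x * y \<le> r \<and> x / y \<notin> \<rat> \<and> leave r x y \<in> orbit P_h ?p}"
  have "inj_on (\<lambda>(x, y). leave r x y) N"
    using r by (auto simp: inj_on_def N_def leave_eq_iff)
  moreover have "(\<lambda>(x, y). leave r x y) ` N \<subseteq> orbit P_h ?p" by (auto simp: N_def)
  ultimately have "finite N"
    using finite_orbit[OF p] by (metis finite_imageD finite_subset)
  have closed: "q' \<in> orbit P_h ?p" if "q \<in> orbit P_h ?p" "reaches P_h q q'" for q q'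
    using that funpow_in_orbit by (auto simp: reaches_def)
  have \<gamma>: "\<gamma> > 0" "\<gamma> \<le> r" "?p = enter r \<gamma> 1 \<or> ?p = leave r \<gamma> 1"
    using W_eq_enter_or_leave[OF assms(1), of 1] by simp_all
  then have "reaches P_h ?p (leave r \<gamma> 1)"
    using reaches_enter_leave[of \<gamma> 1 r] by auto
  then have "leave r \<gamma> 1 \<in> orbit P_h ?p" by (rule closed[OF p])
  then have "(\<gamma>, 1) \<in> N" using assms(2) \<gamma>(1,2) by (simp add: N_def)
  then have "N \<noteq> {}" by blast
  \<comment> \<open>A node of \<open>N\<close> with minimal coordinate sum; its parent will also lie
    in \<open>N\<close> and have a smaller sum.\<close>
  then obtain m where m: "m \<in> (\<lambda>(x, y). x + y) ` N"
      "\<not> (\<exists>k \<in> (\<lambda>(x, y). x + y) ` N. k < m)"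
    using ex_min_if_finite[of "(\<lambda>(x, y). x + y) ` N"] \<open>finite N\<close> by blast
  then obtain x y where q: "(x, y) \<in> N" and xy: "m = x + y" by auto
  have min: "x + y \<le> x' + y'" if "(x', y') \<in> N" for x' y'
    using m(2) that unfolding xy by (auto simp: not_less)
  have N: "x > 0" "y > 0" "x * y \<le> r" "x / y \<notin> \<rat>" "leave r x y \<in> orbit P_h ?p"
    using q by (auto simp: N_def)
  \<comment> \<open>Equal coordinates would give the rational ratio 1, so (x, y) has a
    parent.\<close>
  have "x \<noteq> y" using N(2,4) by auto
  then consider "x < y" | "y < x" by linarith
  then show False
  proof cases
    case 1
    have "reaches P_h (leave r x y) (leave r x (y - x))"
      using reaches_leave_left[of x "y - x" r] N 1 by simp
    moreover have "x / (y - x) \<notin> \<rat>"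
    proof
      assume "x / (y - x) \<in> \<rat>"
      then have "1 + 1 / (x / (y - x)) \<in> \<rat>" by (rule Rats_add[OF Rats_1 Rats_divide[OF Rats_1]])
      also have "1 + 1 / (x / (y - x)) = y / x" using N 1 by (simp add: diff_divide_distrib)
      finally have "1 / (y / x) \<in> \<rat>" by (rule Rats_divide[OF Rats_1])
      then show False using N by simp
    qed
    moreover have "x * (y - x) \<le> r" using mult_left_mono[of "y - x" y x] N by linarith
    ultimately have "(x, y - x) \<in> N" using N 1 closed[OF N(5)] unfolding N_def by simp
    from min[OF this] show False using N by simp
  next
    case 2
    have "reaches P_h (leave r x y) (leave r (x - y) y)"
      using reaches_leave_right[of "x - y" y r] N 2 by simp
    moreover have "(x - y) / y \<notin> \<rat>"
    proof
      assume "(x - y) / y \<in> \<rat>"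
      then have "(x - y) / y + 1 \<in> \<rat>" by (rule Rats_add[OF _ Rats_1])
      also have "(x - y) / y + 1 = x / y" using N by (simp add: diff_divide_distrib)
      finally show False using N by simp
    qed
    moreover have "(x - y) * y \<le> r" using mult_right_mono[of "x - y" x y] N by linarith
    ultimately have "(x - y, y) \<in> N" using N 2 closed[OF N(5)] unfolding N_def by simp
    from min[OF this] show False using N by simp
  qed
qed

lemma W_in_orbit_w:
  fixes a b :: nat
  assumes "(\<gamma>, r, \<epsilon>) \<in> \<W>" "a \<ge> 1" "b \<ge> 1" "coprime a b" "\<gamma> = real a / real b"
  shows "r * (real b)\<^sup>2 \<ge> 1" "(\<gamma>, r, \<epsilon>) \<in> orbit P_h (w (r * (real b)\<^sup>2))"
proof -
  have a: "\<gamma> * real b = real a" using assms by simp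
  note W = W_eq_enter_or_leave[OF assms(1), of "real b", unfolded a]
  have "1 \<le> real (a * b)" using mult_le_mono[OF assms(2,3)] by linarith
  also have ab: "real (a * b) \<le> r * (real b)\<^sup>2" using W assms by simp
  finally show ge: "r * (real b)\<^sup>2 \<ge> 1" .
  show "(\<gamma>, r, \<epsilon>) \<in> orbit P_h (w (r * (real b)\<^sup>2))"
    unfolding orbit_w[OF ge] states_iff
    using W(3) ab assms(2-4) by (intro exI[of _ a] exI[of _ b]) simp
qed

theorem theorem5p8:
  shows "(\<forall>r::real. r \<ge> 1 \<longrightarrow>
            w r \<in> \<W> \<and> periodic_point P_h (w r) \<and> least_power P_h (w r) = per r)
       \<and> (\<forall>\<gamma> r \<epsilon>. (\<gamma>, r, \<epsilon>) \<in> \<W> \<longrightarrow>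
            (periodic_point P_h (\<gamma>, r, \<epsilon>) \<longleftrightarrow> \<gamma> \<in> \<rat>)
          \<and> (\<forall>a b :: nat. a \<ge> 1 \<and> b \<ge> 1 \<and> coprime a b \<and> \<gamma> = real a / real b \<longrightarrow>
                (\<gamma>, r, \<epsilon>) \<in> orbit P_h (w (r * (real b)\<^sup>2))))"
proof (intro conjI allI impI)
  fix r :: real assume r: "r \<ge> 1"
  show "w r \<in> \<W>" using r by (auto simp: w_def \<W>_def)
  show "periodic_point P_h (w r)"
    using w_in_orbit_w[OF r] by (simp add: periodic_point_iff_orbit)
  show "least_power P_h (w r) = per r"
    using least_power_eq_card_orbit[OF w_in_orbit_w[OF r]] orbit_w[OF r] card_states[of r] r by simp
next
  fix \<gamma> r :: real and \<epsilon> :: int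
  assume W: "(\<gamma>, r, \<epsilon>) \<in> \<W>"
  show "periodic_point P_h (\<gamma>, r, \<epsilon>) \<longleftrightarrow> \<gamma> \<in> \<rat>"
  proof
    assume "\<gamma> \<in> \<rat>"
    then obtain a b :: nat where ab: "b \<noteq> 0" "\<bar>\<gamma>\<bar> = real a / real b" "coprime a b"
      by (rule Rats_abs_nat_div_natE)
    moreover have "\<gamma> > 0" using W by (simp add: \<W>_def)
    ultimately have "\<gamma> = real a / real b" "a \<ge> 1" "b \<ge> 1" by (auto simp: zero_less_divide_iff)
    from W_in_orbit_w[OF W this(2,3) ab(3) this(1)]
    \<comment> \<open>All points in the orbit of the periodic point
      \<open>w (r * (real b)\<^sup>2)\<close> are periodic.\<close>
    show "periodic_point P_h (\<gamma>, r, \<epsilon>)"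
      using self_in_orbit_trans w_in_orbit_w by (metis periodic_point_iff_orbit)
  next
    assume "periodic_point P_h (\<gamma>, r, \<epsilon>)"
    then show "\<gamma> \<in> \<rat>" using not_periodic_if_irrational[OF W] by blast
  qed
  fix a b :: nat assume "a \<ge> 1 \<and> b \<ge> 1 \<and> coprime a b \<and> \<gamma> = real a / real b"
  then show "(\<gamma>, r, \<epsilon>) \<in> orbit P_h (w (r * (real b)\<^sup>2))"
    using W_in_orbit_w(2)[OF W] by blast
qed

end
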